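(* Suppose that $\nu$ is a stationary tail measure on $\mathbf{F}$ with index $\alpha>0$. Then $\nu$ has a spectral representation (with index $\alpha$): there is a probability measure $\mathbb{Q}^*$ on $\mathbf{F}$ such that $$\nu=\mathbb{E}_{\mathbb{Q}^*}\int\mathbf 1\{uY\in\cdot,\,u>0\}\,\alpha u^{-\alpha-1}\,du,$$ and moreover $\mathbb{Q}^*$ can be chosen to satisfy $$\mathbb{E}_{\mathbb{Q}^*}\int g(Y,s)|Y_s|^\alpha\,\lambda(ds)=\mathbb{E}_{\mathbb{Q}^*}\int g(\theta_{-s}Y,s)|Y_0|^\alpha\,\lambda(ds)$$ for all measurable $g\colon\mathbf{F}\times\mathbb{G}\to[0,\infty]$ which are $0$-homogeneous in the first argument (i.e. $g(u\omega,s)=g(\omega,s)$ for all $u>0$), and $$\mathbb{E}_{\mathbb{Q}^*}|Y_s|^\alpha=1\quad\text{for }\lambda\text{-a.e. }s\in\mathbb{G}.$$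
   Context: $\mathbb{G}$ is a locally compact Hausdorff Abelian group (additive, neutral element $0$) with Borel $\sigma$-field $\mathcal{G}$ and non-trivial Haar measure $\lambda$. $\mathbb{H}$ is a non-empty Polish space with Borel $\sigma$-field $\mathcal{H}$ which is a measurable cone: there is a measurable map $(u,x)\mapsto ux$ from $(0,\infty)\times\mathbb{H}$ to $\mathbb{H}$ with $1x=x$, $u(vx)=(uv)x$. $|\cdot|\colon\mathbb{H}\to[0,\infty)$ is measurable with $|ux|=u|x|$ for $u>0$; there is an element $x_0\in\mathbb{H}$ with $|x_0|=1$. For $\omega\in\mathbb{H}^{\mathbb{G}}$ let $\theta_s\omega:=\omega(\cdot+s)$ and $(u\omega)(s):=u\,\omega(s)$. $\mathbf{F}\subset\mathbb{H}^{\mathbb{G}}$ is a set of functions closed under all $\theta_s$ and under multiplication by $u\in(0,\infty)$, with a $\sigma$-field $\mathcal{F}$ such that $(\omega,s)\mapsto(\theta_s\omega,\omega(0))$ (on $\mathbf{F}\times\mathbb{G}$) and $(\omega,u)\mapsto u\omega$ (on $\mathbf{F}\times(0,\infty)$) are measurable. If $\mathbb{G}$ is discrete, $\mathbf{F}=\mathbb{H}^{\mathbb{G}}$ with the product $\sigma$-field. $Y_s(\omega):=\omega(s)$, and $Y=(Y_s)_{s\in\mathbb{G}}$ is the identity on $\mathbf{F}$. $\mathbb{E}_\mu$ denotes integration with respect to $\mu$; $0\cdot\infty=0$. Let $\xi:=\int\mathbf 1\{s\in\cdot,\,|Y_s|>1\}\,\lambda(ds)$. A measure $\nu$ on $\mathbf{F}$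 is a tail measure with index $\alpha>0$ if: $\int\mathbf 1\{|Y_s|>0\}\,\lambda(ds)>0$ $\nu$-a.e.; $\mathbb{E}_\nu\xi(B)<\infty$ for all compact $B\in\mathcal{G}$; and $\nu(uY\in\cdot)=u^\alpha\nu(Y\in\cdot)$ for all $u>0$. It is stationary if it is invariant under all shifts $\theta_s$; a stationary tail measure is always assumed normalized by $\nu(|Y_0|>1)=1$ (equivalently $\mathbb{E}_\nu\xi(B)=\lambda(B)$ for all $B\in\mathcal{G}$).
   Formalization: The group G is additionally assumed σ-compact (equivalently, Haar measure λ is σ-finite); without this the claim fails, e.g. for G = R × D with D an uncountable discrete group of cardinality ω₁. *)

theory Defs
  imports "HOL-Probability.Probability"
begin

definition haar_measure :: "'g::{topological_ab_group_add, t2_space} measure \<Rightarrow> bool" where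
  "haar_measure lam \<longleftrightarrow>
     sets lam = sets borel \<and>
     emeasure lam UNIV \<noteq> 0 \<and>
     (\<forall>s. distr lam borel (\<lambda>t. t + s) = lam) \<and>
     (\<forall>K. compact K \<longrightarrow> emeasure lam K < \<infinity>) \<and>
     (\<forall>B\<in>sets borel. emeasure lam B = (INF U\<in>{U. open U \<and> B \<subseteq> U}. emeasure lam U)) \<and>
     (\<forall>U. open U \<longrightarrow> emeasure lam U = (SUP K\<in>{K. compact K \<and> K \<subseteq> U}. emeasure lam K))"

definition sigma_compact_space :: "'g::topological_space topology \<Rightarrow> bool" where
  "sigma_compact_space X \<longleftrightarrow>
     (\<exists>\<K>. countable \<K> \<and> (\<forall>K\<in>\<K>. compactin X K) \<and> \<Union>\<K> = topspace X)"

text \<open>Only the values of \<open>cmul u x\<close> for \<open>u > 0\<close> are relevant.\<close>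

locale measurable_cone =
  fixes cmul :: "real \<Rightarrow> 'h::polish_space \<Rightarrow> 'h"
    and nrm :: "'h \<Rightarrow> real"
  assumes cmul_measurable:
      "(\<lambda>(u, x). cmul u x) \<in> restrict_space borel {0<..} \<Otimes>\<^sub>M borel \<rightarrow>\<^sub>M borel"
    and cmul_one: "cmul 1 x = x"
    and cmul_cmul: "u > 0 \<Longrightarrow> v > 0 \<Longrightarrow> cmul u (cmul v x) = cmul (u * v) x"
    and nrm_measurable: "nrm \<in> borel_measurable borel"
    and nrm_nonneg: "nrm x \<ge> 0"
    and nrm_cmul: "u > 0 \<Longrightarrow> nrm (cmul u x) = u * nrm x"
    and nrm_eq_1: "\<exists>x. nrm x = 1"

definition shift_by :: "'g::ab_group_add \<Rightarrow> ('g \<Rightarrow> 'h) \<Rightarrow> 'g \<Rightarrow> 'h" where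
  "shift_by s \<omega> = (\<lambda>t. \<omega> (t + s))"

definition dilate :: "(real \<Rightarrow> 'h \<Rightarrow> 'h) \<Rightarrow> real \<Rightarrow> ('g \<Rightarrow> 'h) \<Rightarrow> 'g \<Rightarrow> 'h" where
  "dilate cmul u \<omega> = (\<lambda>t. cmul u (\<omega> t))"

text \<open>The set of functions together with its \<open>\<sigma>\<close>-field is encoded by a single object \<open>F\<close> of
  type \<open>measure\<close>, of which only \<open>space F\<close> and \<open>sets F\<close> are used.\<close>

locale function_space = measurable_cone cmul nrm
  for cmul :: "real \<Rightarrow> 'h::polish_space \<Rightarrow> 'h" and nrm :: "'h \<Rightarrow> real" +
  fixes F :: "('g::{topological_ab_group_add, t2_space} \<Rightarrow> 'h) measure"
  assumes shift_closed: "\<omega> \<in> space F \<Longrightarrow> shift_by s \<omega> \<in> space F"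
    and dilate_closed: "\<omega> \<in> space F \<Longrightarrow> u > 0 \<Longrightarrow> dilate cmul u \<omega> \<in> space F"
    and shift_measurable:
      "(\<lambda>(\<omega>, s). (shift_by s \<omega>, \<omega> 0)) \<in> F \<Otimes>\<^sub>M borel \<rightarrow>\<^sub>M F \<Otimes>\<^sub>M borel"
    and dilate_measurable:
      "(\<lambda>(\<omega>, u). dilate cmul u \<omega>) \<in> F \<Otimes>\<^sub>M restrict_space borel {0<..} \<rightarrow>\<^sub>M F"
    and discrete_case:
      "(\<forall>S :: 'g set. open S) \<Longrightarrow> space F = UNIV \<and> sets F = sets (\<Pi>\<^sub>M s\<in>UNIV. borel)"

definition exceedance ::
  "'g measure \<Rightarrow> ('h \<Rightarrow> real) \<Rightarrow> ('g \<Rightarrow> 'h) \<Rightarrow> 'g set \<Rightarrow> ennreal" where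
  "exceedance lam nrm \<omega> B = (\<integral>\<^sup>+ s. indicator B s * indicator {s. nrm (\<omega> s) > 1} s \<partial>lam)"

definition tail_measure ::
  "'g::{topological_ab_group_add, t2_space} measure \<Rightarrow> (real \<Rightarrow> 'h \<Rightarrow> 'h) \<Rightarrow> ('h \<Rightarrow> real) \<Rightarrow>
   ('g \<Rightarrow> 'h) measure \<Rightarrow> real \<Rightarrow> ('g \<Rightarrow> 'h) measure \<Rightarrow> bool" where
  "tail_measure lam cmul nrm F \<alpha> \<nu> \<longleftrightarrow>
     \<alpha> > 0 \<and> sets \<nu> = sets F \<and>
     (AE \<omega> in \<nu>. (\<integral>\<^sup>+ s. indicator {s. nrm (\<omega> s) > 0} s \<partial>lam) > 0) \<and>
     (\<forall>B. compact B \<longrightarrow> (\<integral>\<^sup>+ \<omega>. exceedance lam nrm \<omega> B \<partial>\<nu>) < \<infinity>) \<and>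
     (\<forall>u>0. \<forall>A\<in>sets F.
        emeasure \<nu> {\<omega> \<in> space F. dilate cmul u \<omega> \<in> A} = ennreal (u powr \<alpha>) * emeasure \<nu> A)"

definition stationary :: "('g::ab_group_add \<Rightarrow> 'h) measure \<Rightarrow> bool" where
  "stationary \<nu> \<longleftrightarrow> (\<forall>s. \<forall>A\<in>sets \<nu>. emeasure \<nu> {\<omega> \<in> space \<nu>. shift_by s \<omega> \<in> A} = emeasure \<nu> A)"

definition stationary_tail_measure ::
  "'g::{topological_ab_group_add, t2_space} measure \<Rightarrow> (real \<Rightarrow> 'h \<Rightarrow> 'h) \<Rightarrow> ('h \<Rightarrow> real) \<Rightarrow>
   ('g \<Rightarrow> 'h) measure \<Rightarrow> real \<Rightarrow> ('g \<Rightarrow> 'h) measure \<Rightarrow> bool" where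
  "stationary_tail_measure lam cmul nrm F \<alpha> \<nu> \<longleftrightarrow>
     tail_measure lam cmul nrm F \<alpha> \<nu> \<and> stationary \<nu> \<and>
     emeasure \<nu> {\<omega> \<in> space \<nu>. nrm (\<omega> 0) > 1} = 1"

definition spectral_representation ::
  "(real \<Rightarrow> 'h \<Rightarrow> 'h) \<Rightarrow> ('g \<Rightarrow> 'h) measure \<Rightarrow> real \<Rightarrow> ('g \<Rightarrow> 'h) measure \<Rightarrow>
   ('g \<Rightarrow> 'h) measure \<Rightarrow> bool" where
  "spectral_representation cmul F \<alpha> \<nu> Q \<longleftrightarrow>
     prob_space Q \<and> sets Q = sets F \<and>
     (\<forall>A\<in>sets F. emeasure \<nu> A =
        (\<integral>\<^sup>+ \<omega>. (\<integral>\<^sup>+ u. indicator {u. u > 0 \<and> dilate cmul u \<omega> \<in> A} u *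
                     ennreal (\<alpha> * u powr (- \<alpha> - 1)) \<partial>lborel) \<partial>Q))"

end

theory Submission
  imports Defs
begin

text \<open>
  Let \<open>f \<ge> 0\<close> be a \<open>\<nu>\<close>-integrable function on path space, with integral \<open>c\<close>, whose weighted orbit
  integral \<open>\<rho>(\<omega>) = \<integral> f(\<omega> / v) \<alpha> v\<^bsup>\<alpha>-1\<^esup> dv\<close> lies in \<open>(0, \<infinity>)\<close> for \<open>\<nu>\<close>-almost all \<open>\<omega>\<close>. Since \<open>\<rho>\<close> is
  \<open>\<alpha>\<close>-homogeneous, the homogeneity of \<open>\<nu>\<close> and Fubini show that the law of \<open>(c / \<rho>(Y))\<^bsup>1/\<alpha>\<^esup> Y\<close>
  under the probability measure \<open>(f / c) \<nu>\<close> is a spectral representation.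
  Such an \<open>f\<close> is found by choosing a finite measure \<open>\<mu>\<close> equivalent to Haar measure for which
  \<open>e(\<omega>) = \<mu>{|\<omega>| > 1}\<close> is \<open>\<nu>\<close>-integrable, and setting \<open>M(\<omega>) = \<mu>{|\<omega>| > 0}\<close> and \<open>f = M \<one>{2e > M}\<close>.

  The other two properties hold for every spectral representation \<open>Q\<close>: if \<open>G\<close> is 0-homogeneous,
  then \<open>E\<^sub>Q G(Y) |Y\<^sub>s|\<^sup>\<alpha> = E\<^sub>\<nu> G(Y) \<one>{|Y\<^sub>s| > 1}\<close>, and the right-hand side is governed by stationarity.
\<close>

section \<open>Power measures on the positive half-line\<close>

text \<open>The exponent \<open>e\<close> is kept apart from the factor \<open>\<alpha>\<close>
  because two cases share the scaling rule: \<open>e = - \<alpha>\<close> is the radial measure of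
  the spectral representation, \<open>e = \<alpha>\<close> is the weight in the orbit
  integral.\<close>

definition power_measure :: "real \<Rightarrow> real \<Rightarrow> real measure" where
  "power_measure \<alpha> e = density lborel (\<lambda>u. indicator {0<..} u * ennreal (\<alpha> * u powr (e - 1)))"

lemma sets_power_measure [simp, measurable_cong]: "sets (power_measure \<alpha> e) = sets borel"
  by (simp add: power_measure_def)

lemma space_power_measure [simp]: "space (power_measure \<alpha> e) = UNIV"
  by (simp add: power_measure_def)

lemma sigma_finite_power_measure: "sigma_finite_measure (power_measure \<alpha> e)"
  unfolding power_measure_def
  by (subst sigma_finite_measure.sigma_finite_iff_density_finite[OF sigma_finite_lborel])
     (auto simp: ennreal_mult_eq_top_iff indicator_def)

lemma nn_integral_power_measure:
  assumes [measurable]: "\<phi> \<in> borel_measurable borel"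
  shows "(\<integral>\<^sup>+ u. \<phi> u \<partial>power_measure \<alpha> e) =
    (\<integral>\<^sup>+ u. indicator {0<..} u * ennreal (\<alpha> * u powr (e - 1)) * \<phi> u \<partial>lborel)"
  unfolding power_measure_def by (subst nn_integral_density) auto

lemma AE_power_measure_pos: "AE u in power_measure \<alpha> e. u > 0"
  unfolding power_measure_def by (subst AE_density) (auto simp: indicator_def)

text \<open>The substitution u -> r u contributes r from du and r^(e-1) from the density. This is
  the source of the homogeneity of all integrals along orbits.\<close>

lemma nn_integral_power_measure_scale:
  assumes [measurable]: "\<phi> \<in> borel_measurable borel" and r: "r > 0"
  shows "(\<integral>\<^sup>+ u. \<phi> u \<partial>power_measure \<alpha> e) =
    ennreal (r powr e) * (\<integral>\<^sup>+ u. \<phi> (r * u) \<partial>power_measure \<alpha> e)"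
proof -
  \<comment> \<open>The summand 0 keeps the shape of the affine substitution rule applied
    below.\<close>
  have eq: "ennreal r * (indicator {0<..} (0 + r * u) * ennreal (\<alpha> * (0 + r * u) powr (e - 1)) * \<phi> (0 + r * u)) =
     ennreal (r powr e) * (indicator {0<..} u * ennreal (\<alpha> * u powr (e - 1)) * \<phi> (r * u))" for u
  proof (cases "u > 0")
    case True
    have "r * (\<alpha> * (r * u) powr (e - 1)) = (r * r powr (e - 1)) * (\<alpha> * u powr (e - 1))"
      using r True by (simp add: powr_mult)
    also have "r * r powr (e - 1) = r powr e"
      using r powr_add[of r 1 "e - 1"] by simp
    finally have "ennreal (r * (\<alpha> * (r * u) powr (e - 1))) = ennreal (r powr e * (\<alpha> * u powr (e - 1)))"
      by (rule arg_cong)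
    then have "ennreal r * ennreal (\<alpha> * (r * u) powr (e - 1)) = ennreal (r powr e) * ennreal (\<alpha> * u powr (e - 1))"
      using r by (simp add: ennreal_mult')
    then show ?thesis
      using r True by (simp add: mult.assoc[symmetric])
  next
    case False
    then show ?thesis
      using r by (simp add: zero_less_mult_iff)
  qed
  have "(\<integral>\<^sup>+ u. \<phi> u \<partial>power_measure \<alpha> e) = (\<integral>\<^sup>+ u. ennreal r *
      (indicator {0<..} (0 + r * u) * ennreal (\<alpha> * (0 + r * u) powr (e - 1)) * \<phi> (0 + r * u)) \<partial>lborel)"
    using r by (subst nn_integral_power_measure, simp,
      subst nn_integral_real_affine[where c = r and t = 0]) (auto simp: nn_integral_cmult)
  also have "\<dots> = ennreal (r powr e) * (\<integral>\<^sup>+ u. \<phi> (r * u) \<partial>power_measure \<alpha> e)"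
    unfolding eq by (subst nn_integral_power_measure) (auto simp: nn_integral_cmult)
  finally show ?thesis .
qed

lemma emeasure_power_measure_Ioi:
  assumes "\<alpha> > 0" "x > 0"
  shows "emeasure (power_measure \<alpha> (- \<alpha>)) {x<..} = ennreal (x powr (- \<alpha>))"
proof -
  have "emeasure (power_measure \<alpha> (- \<alpha>)) {x<..} = (\<integral>\<^sup>+ u. indicator {x<..} u \<partial>power_measure \<alpha> (- \<alpha>))"
    by simp
  \<comment> \<open>The endpoint is a null set; adding it gives the closed half-line on which the
    antiderivative \<open>- (u powr (- \<alpha>))\<close> is evaluated.\<close>
  also have "\<dots> = (\<integral>\<^sup>+ u. ennreal (\<alpha> * u powr (- \<alpha> - 1)) * indicator {x..} u \<partial>lborel)"
  proof (subst nn_integral_power_measure, simp, rule nn_integral_cong_AE)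
    show "AE u in lborel. indicator {0<..} u * ennreal (\<alpha> * u powr (- \<alpha> - 1)) * indicator {x<..} u =
      ennreal (\<alpha> * u powr (- \<alpha> - 1)) * indicator {x..} u"
      using AE_lborel_singleton[of x] by eventually_elim (use \<open>x > 0\<close> in \<open>auto simp: indicator_def\<close>)
  qed
  also have "\<dots> = ennreal (0 - (- (x powr (- \<alpha>))))"
  proof (rule nn_integral_FTC_atLeast)
    have "((\<lambda>u. u powr (- \<alpha>)) \<longlongrightarrow> 0) at_top"
      using \<open>\<alpha> > 0\<close> by (intro tendsto_neg_powr filterlim_ident) auto
    from tendsto_minus[OF this] show "((\<lambda>u. - (u powr (- \<alpha>))) \<longlongrightarrow> 0) at_top"
      by simp
  next
    fix u assume "x \<le> u"
    then show "((\<lambda>u. - (u powr (- \<alpha>))) has_real_derivative \<alpha> * u powr (- \<alpha> - 1)) (at u)"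
      using \<open>x > 0\<close> by (auto intro!: derivative_eq_intros)
  qed (use assms in auto)
  finally show ?thesis by simp
qed

text \<open>For \<alpha> < 1 the density is unbounded at 0 but still integrable there, its exponent
  being greater than -1. The finite positive mass of bounded intervals later controls the orbit
  integral from both sides.\<close>

lemma emeasure_power_measure_Ioc:
  assumes "\<alpha> > 0" "x > 0"
  shows "emeasure (power_measure \<alpha> \<alpha>) {0<..x} = ennreal (x powr \<alpha>)"
proof -
  have "((\<lambda>u. \<alpha> * u powr (\<alpha> - 1)) has_integral (\<alpha> * (x powr ((\<alpha> - 1) + 1) / ((\<alpha> - 1) + 1)))) {0..x}"
    using assms by (intro has_integral_mult_right has_integral_powr_from_0) auto
  from nn_integral_has_integral_lebesgue'[OF _ this]
  have "(\<integral>\<^sup>+ u. ennreal (\<alpha> * u powr (\<alpha> - 1)) * indicator {0..x} u \<partial>lborel) = ennreal (x powr \<alpha>)"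
    using assms by simp
  moreover have "emeasure (power_measure \<alpha> \<alpha>) {0<..x} = (\<integral>\<^sup>+ u. indicator {0<..x} u \<partial>power_measure \<alpha> \<alpha>)"
    by simp
  moreover have "\<dots> = (\<integral>\<^sup>+ u. ennreal (\<alpha> * u powr (\<alpha> - 1)) * indicator {0..x} u \<partial>lborel)"
    by (subst nn_integral_power_measure) (auto intro!: nn_integral_cong simp: indicator_def)
  ultimately show ?thesis by simp
qed

section \<open>Joint measurability of dilations, shifts and evaluations\<close>

context function_space
begin

text \<open>Extending the dilations by the identity to nonpositive factors makes them jointly
  measurable on \<open>F \<Otimes>\<^sub>M borel\<close> without restricting the space of factors.\<close>

definition dil :: "real \<Rightarrow> ('g \<Rightarrow> 'h) \<Rightarrow> 'g \<Rightarrow> 'h" where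
  "dil u \<omega> = dilate cmul (if u > 0 then u else 1) \<omega>"

lemma dil_eq: "u > 0 \<Longrightarrow> dil u \<omega> = dilate cmul u \<omega>"
  by (simp add: dil_def)

lemma dil_in_space: "\<omega> \<in> space F \<Longrightarrow> dil u \<omega> \<in> space F"
  by (simp add: dil_def dilate_closed)

lemma dil_dil: "u > 0 \<Longrightarrow> v > 0 \<Longrightarrow> dil u (dil v \<omega>) = dil (u * v) \<omega>"
  by (simp add: dil_def dilate_def cmul_cmul)

lemma dil_one [simp]: "dil 1 \<omega> = \<omega>"
  by (simp add: dil_def dilate_def cmul_one)

lemma shift_dil: "shift_by s (dil u \<omega>) = dil u (shift_by s \<omega>)"
  by (simp add: dil_def dilate_def shift_by_def)

lemma nrm_dil: "u > 0 \<Longrightarrow> nrm (dil u \<omega> s) = u * nrm (\<omega> s)"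
  by (simp add: dil_def dilate_def nrm_cmul)

lemma measurable_dil [measurable (raw)]:
  assumes [measurable]: "f \<in> M \<rightarrow>\<^sub>M F" "u \<in> borel_measurable M"
  shows "(\<lambda>x. dil (u x) (f x)) \<in> M \<rightarrow>\<^sub>M F"
proof -
  have "(\<lambda>x. if u x > 0 then u x else 1) \<in> M \<rightarrow>\<^sub>M restrict_space borel {0<..}"
    by (intro measurable_restrict_space2) auto
  from measurable_compose[OF measurable_Pair[OF assms(1) this] dilate_measurable]
  show ?thesis
    by (simp add: dil_def)
qed

lemma measurable_shift_by [measurable (raw)]:
  assumes [measurable]: "f \<in> M \<rightarrow>\<^sub>M F" "s \<in> borel_measurable M"
  shows "(\<lambda>x. shift_by (s x) (f x)) \<in> M \<rightarrow>\<^sub>M F"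
  using measurable_compose[OF measurable_compose[OF measurable_Pair[OF assms] shift_measurable]
    measurable_fst]
  by simp

text \<open>Only evaluation at 0 is measurable by assumption; evaluation at a varying point is a
  shift to that point followed by evaluation at 0.\<close>

lemma measurable_eval [measurable (raw)]:
  assumes [measurable]: "f \<in> M \<rightarrow>\<^sub>M F" "s \<in> borel_measurable M"
  shows "(\<lambda>x. (f x) (s x)) \<in> borel_measurable M"
proof -
  have *: "(\<lambda>\<omega>. \<omega> 0) \<in> borel_measurable F"
    using measurable_compose[OF measurable_compose[OF measurable_Pair[OF measurable_ident
      measurable_const[of 0]] shift_measurable] measurable_snd]
    by simp
  have "(\<lambda>x. (shift_by (s x) (f x)) 0) \<in> borel_measurable M"
    by (rule measurable_compose[OF _ *]) measurable
  then show ?thesis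
    by (simp add: shift_by_def)
qed

lemma measurable_nrm [measurable (raw)]:
  "h \<in> borel_measurable M \<Longrightarrow> (\<lambda>x. nrm (h x)) \<in> borel_measurable M"
  by (rule measurable_compose[OF _ nrm_measurable])

section \<open>Integration against a spectral representation\<close>

text \<open>The density vanishes off the positive half-line and so absorbs the condition
  \<open>u > 0\<close>. What remains is jointly measurable in \<open>\<omega>\<close> and
  \<open>u\<close>, the form needed for Fubini.\<close>

lemma spectral_representation_iff:
  assumes "\<alpha> > 0"
  shows "spectral_representation cmul F \<alpha> \<nu> Q \<longleftrightarrow> prob_space Q \<and> sets Q = sets F \<and>
    (\<forall>A\<in>sets F. emeasure \<nu> A =
      (\<integral>\<^sup>+ \<omega>. (\<integral>\<^sup>+ u. indicator A (dil u \<omega>) \<partial>power_measure \<alpha> (- \<alpha>)) \<partial>Q))"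
proof -
  have "(\<integral>\<^sup>+ \<omega>. (\<integral>\<^sup>+ u. indicator {u. u > 0 \<and> dilate cmul u \<omega> \<in> A} u *
                     ennreal (\<alpha> * u powr (- \<alpha> - 1)) \<partial>lborel) \<partial>Q) =
     (\<integral>\<^sup>+ \<omega>. (\<integral>\<^sup>+ u. indicator A (dil u \<omega>) \<partial>power_measure \<alpha> (- \<alpha>)) \<partial>Q)"
    if sets: "sets Q = sets F" and [measurable]: "A \<in> sets F" for A
  proof (rule nn_integral_cong)
    fix \<omega> assume "\<omega> \<in> space Q"
    then have [measurable]: "\<omega> \<in> space F"
      using sets_eq_imp_space_eq[OF sets] by simp
    show "(\<integral>\<^sup>+ u. indicator {u. u > 0 \<and> dilate cmul u \<omega> \<in> A} u *
                     ennreal (\<alpha> * u powr (- \<alpha> - 1)) \<partial>lborel) =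
      (\<integral>\<^sup>+ u. indicator A (dil u \<omega>) \<partial>power_measure \<alpha> (- \<alpha>))"
      by (subst nn_integral_power_measure)
         (auto intro!: nn_integral_cong simp: indicator_def dil_eq)
  qed
  then show ?thesis
    unfolding spectral_representation_def by auto
qed

text \<open>The representation says that \<open>\<nu>\<close> is the image of the product of
  \<open>Q\<close> and the radial measure under \<open>dil\<close>; the rest is change of variables
  and Tonelli.\<close>

lemma nn_integral_spectral:
  assumes "\<alpha> > 0" and rep: "spectral_representation cmul F \<alpha> \<nu> Q" and [measurable_cong]: "sets \<nu> = sets F"
    and [measurable]: "\<Phi> \<in> borel_measurable F"
  shows "(\<integral>\<^sup>+ \<omega>. \<Phi> \<omega> \<partial>\<nu>) = (\<integral>\<^sup>+ \<omega>. (\<integral>\<^sup>+ u. \<Phi> (dil u \<omega>) \<partial>power_measure \<alpha> (- \<alpha>)) \<partial>Q)"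
proof -
  let ?m = "power_measure \<alpha> (- \<alpha>)"
  interpret m: sigma_finite_measure ?m
    by (rule sigma_finite_power_measure)
  from rep have sQ [measurable_cong]: "sets Q = sets F"
    by (simp add: spectral_representation_def)
  have "\<nu> = distr (Q \<Otimes>\<^sub>M ?m) F (\<lambda>(\<omega>, u). dil u \<omega>)"
  proof (rule measure_eqI)
    fix A assume "A \<in> sets \<nu>"
    then have [measurable]: "A \<in> sets F"
      by (simp add: assms)
    have "emeasure (distr (Q \<Otimes>\<^sub>M ?m) F (\<lambda>(\<omega>, u). dil u \<omega>)) A =
        (\<integral>\<^sup>+ \<omega>. indicator A \<omega> \<partial>distr (Q \<Otimes>\<^sub>M ?m) F (\<lambda>(\<omega>, u). dil u \<omega>))"
      by simp
    also have "\<dots> = (\<integral>\<^sup>+ p. indicator A (case p of (\<omega>, u) \<Rightarrow> dil u \<omega>) \<partial>(Q \<Otimes>\<^sub>M ?m))"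
      by (rule nn_integral_distr) auto
    also have "\<dots> = (\<integral>\<^sup>+ \<omega>. (\<integral>\<^sup>+ u. indicator A (dil u \<omega>) \<partial>?m) \<partial>Q)"
      by (subst m.nn_integral_fst[symmetric]) auto
    finally show "emeasure \<nu> A = emeasure (distr (Q \<Otimes>\<^sub>M ?m) F (\<lambda>(\<omega>, u). dil u \<omega>)) A"
      using rep \<open>\<alpha> > 0\<close> by (simp add: spectral_representation_iff)
  qed (simp add: assms)
  then have "(\<integral>\<^sup>+ \<omega>. \<Phi> \<omega> \<partial>\<nu>) = (\<integral>\<^sup>+ \<omega>. \<Phi> \<omega> \<partial>distr (Q \<Otimes>\<^sub>M ?m) F (\<lambda>(\<omega>, u). dil u \<omega>))"
    by simp
  also have "\<dots> = (\<integral>\<^sup>+ p. \<Phi> (case p of (\<omega>, u) \<Rightarrow> dil u \<omega>) \<partial>(Q \<Otimes>\<^sub>M ?m))"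
    by (rule nn_integral_distr) auto
  also have "\<dots> = (\<integral>\<^sup>+ \<omega>. (\<integral>\<^sup>+ u. \<Phi> (dil u \<omega>) \<partial>?m) \<partial>Q)"
    by (subst m.nn_integral_fst[symmetric]) auto
  finally show ?thesis .
qed

text \<open>Along the ray through \<open>\<omega>\<close> the function \<open>G\<close> is constant,
  and the norm at \<open>s\<close> exceeds 1 exactly on the half-line of \<open>u\<close> above
  \<open>1 / nrm (\<omega> s)\<close>, whose radial mass is
  \<open>nrm (\<omega> s) powr \<alpha>\<close>. If the norm is 0, the set of such \<open>u\<close>
  is empty and the weight is 0 as well.\<close>

lemma nn_integral_spectral_homogeneous:
  assumes "\<alpha> > 0" and rep: "spectral_representation cmul F \<alpha> \<nu> Q" and [measurable_cong]: "sets \<nu> = sets F"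
    and [measurable]: "G \<in> borel_measurable F"
    and hom: "\<And>\<omega> u. \<omega> \<in> space F \<Longrightarrow> u > 0 \<Longrightarrow> G (dilate cmul u \<omega>) = (G \<omega> :: ennreal)"
  shows "(\<integral>\<^sup>+ \<omega>. G \<omega> * ennreal (nrm (\<omega> s) powr \<alpha>) \<partial>Q) =
    (\<integral>\<^sup>+ \<omega>. G \<omega> * indicator {\<omega>. nrm (\<omega> s) > 1} \<omega> \<partial>\<nu>)"
proof -
  let ?m = "power_measure \<alpha> (- \<alpha>)"
  from rep have sQ [measurable_cong]: "sets Q = sets F"
    by (simp add: spectral_representation_def)
  have [measurable]: "Measurable.pred F (\<lambda>\<omega>. nrm (\<omega> s) > 1)"
    by measurable
  have "(\<integral>\<^sup>+ \<omega>. G \<omega> * indicator {\<omega>. nrm (\<omega> s) > 1} \<omega> \<partial>\<nu>) =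
     (\<integral>\<^sup>+ \<omega>. (\<integral>\<^sup>+ u. G (dil u \<omega>) * indicator {\<omega>. nrm (\<omega> s) > 1} (dil u \<omega>) \<partial>?m) \<partial>Q)"
    using assms(1-3) by (rule nn_integral_spectral) measurable
  also have "\<dots> = (\<integral>\<^sup>+ \<omega>. G \<omega> * ennreal (nrm (\<omega> s) powr \<alpha>) \<partial>Q)"
  proof (rule nn_integral_cong)
    fix \<omega> assume "\<omega> \<in> space Q"
    then have \<omega>: "\<omega> \<in> space F"
      using sets_eq_imp_space_eq[OF sQ] by simp
    let ?x = "nrm (\<omega> s)"
    have "(\<integral>\<^sup>+ u. G (dil u \<omega>) * indicator {\<omega>. nrm (\<omega> s) > 1} (dil u \<omega>) \<partial>?m) =
      (\<integral>\<^sup>+ u. G \<omega> * indicator (if ?x > 0 then {1 / ?x <..} else {}) u \<partial>?m)"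
    proof (rule nn_integral_cong_AE)
      show "AE u in ?m. G (dil u \<omega>) * indicator {\<omega>. nrm (\<omega> s) > 1} (dil u \<omega>) =
        G \<omega> * indicator (if ?x > 0 then {1 / ?x <..} else {}) u"
        using AE_power_measure_pos
      proof eventually_elim
        case (elim u)
        have "u * ?x > 1 \<longleftrightarrow> ?x > 0 \<and> u > 1 / ?x"
          using elim nrm_nonneg[of "\<omega> s"] by (cases "?x = 0") (auto simp: field_simps)
        moreover have "G (dil u \<omega>) = G \<omega>"
          using elim hom[OF \<omega>] by (simp add: dil_eq)
        ultimately show ?case
          using elim by (auto simp: nrm_dil indicator_def)
      qed
    qed
    also have "\<dots> = G \<omega> * emeasure ?m (if ?x > 0 then {1 / ?x <..} else {})"
      by (subst nn_integral_cmult) auto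
    also have "emeasure ?m (if ?x > 0 then {1 / ?x <..} else {}) = ennreal (?x powr \<alpha>)"
      using \<open>\<alpha> > 0\<close> nrm_nonneg[of "\<omega> s"]
      by (auto simp: emeasure_power_measure_Ioi powr_minus powr_divide)
    finally show "(\<integral>\<^sup>+ u. G (dil u \<omega>) * indicator {\<omega>. nrm (\<omega> s) > 1} (dil u \<omega>) \<partial>?m) =
       G \<omega> * ennreal (?x powr \<alpha>)" .
  qed
  finally show ?thesis ..
qed

section \<open>From an integrable function to a spectral representation\<close>

lemma nn_integral_dil:
  assumes [measurable_cong]: "sets \<nu> = sets F"
    and hom: "\<And>u A. u > 0 \<Longrightarrow> A \<in> sets F \<Longrightarrow>
      emeasure \<nu> {\<omega> \<in> space F. dilate cmul u \<omega> \<in> A} = ennreal (u powr \<alpha>) * emeasure \<nu> A"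
    and u: "u > 0" and [measurable]: "\<Phi> \<in> borel_measurable F"
  shows "(\<integral>\<^sup>+ \<omega>. \<Phi> (dil u \<omega>) \<partial>\<nu>) = ennreal (u powr \<alpha>) * (\<integral>\<^sup>+ \<omega>. \<Phi> \<omega> \<partial>\<nu>)"
proof -
  have sp: "space \<nu> = space F"
    using assms(1) by (rule sets_eq_imp_space_eq)
  have "distr \<nu> F (dil u) = scale_measure (ennreal (u powr \<alpha>)) \<nu>"
  proof (rule measure_eqI)
    fix A assume "A \<in> sets (distr \<nu> F (dil u))"
    then have [measurable]: "A \<in> sets F" by simp
    have "emeasure (distr \<nu> F (dil u)) A = emeasure \<nu> (dil u -` A \<inter> space \<nu>)"
      by (rule emeasure_distr) measurable
    also have "dil u -` A \<inter> space \<nu> = {\<omega> \<in> space F. dilate cmul u \<omega> \<in> A}"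
      using u by (auto simp: sp dil_eq)
    finally show "emeasure (distr \<nu> F (dil u)) A = emeasure (scale_measure (ennreal (u powr \<alpha>)) \<nu>) A"
      using u by (simp add: hom)
  qed (simp add: assms)
  moreover have "(\<integral>\<^sup>+ \<omega>. \<Phi> (dil u \<omega>) \<partial>\<nu>) = (\<integral>\<^sup>+ \<omega>. \<Phi> \<omega> \<partial>distr \<nu> F (dil u))"
    by (subst nn_integral_distr) measurable
  ultimately show ?thesis
    by (simp add: nn_integral_scale_measure)
qed

text \<open>With \<open>I A\<close> the radial mass of the part of a ray lying in \<open>A\<close>,
  Fubini expresses \<open>emeasure \<nu> A\<close> as the integral of \<open>I A\<close> with weight
  \<open>f\<close> over \<open>\<rho>\<close>. Since \<open>I A\<close> is \<alpha>-homogeneous,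
  moving \<open>\<omega>\<close> along its ray by a factor whose \<alpha>-th power is
  \<open>c / \<rho> \<omega>\<close> turns this weight into the probability density
  \<open>f \<omega> / c\<close>.\<close>

lemma spectral_representation_exists_if_orbit_integrable:
  assumes \<alpha>: "\<alpha> > 0" and sets_\<nu> [measurable_cong]: "sets \<nu> = sets F"
    and hom: "\<And>u A. u > 0 \<Longrightarrow> A \<in> sets F \<Longrightarrow>
      emeasure \<nu> {\<omega> \<in> space F. dilate cmul u \<omega> \<in> A} = ennreal (u powr \<alpha>) * emeasure \<nu> A"
    and sigma_finite: "sigma_finite_measure \<nu>" and nonzero: "emeasure \<nu> (space \<nu>) \<noteq> 0"
    and f [measurable]: "f \<in> borel_measurable F" and f_int: "(\<integral>\<^sup>+ \<omega>. f \<omega> \<partial>\<nu>) < \<infinity>"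
    and orbit: "AE \<omega> in \<nu>. 0 < (\<integral>\<^sup>+ v. f (dil (1 / v) \<omega>) \<partial>power_measure \<alpha> \<alpha>) \<and>
      (\<integral>\<^sup>+ v. f (dil (1 / v) \<omega>) \<partial>power_measure \<alpha> \<alpha>) < \<infinity>"
  shows "\<exists>Q. spectral_representation cmul F \<alpha> \<nu> Q"
proof -
  let ?p = "power_measure \<alpha> \<alpha>" and ?m = "power_measure \<alpha> (- \<alpha>)"
  define \<rho> where "\<rho> \<omega> = (\<integral>\<^sup>+ v. f (dil (1 / v) \<omega>) \<partial>?p)" for \<omega>
  define I where "I A \<omega> = (\<integral>\<^sup>+ v. indicator A (dil v \<omega>) \<partial>?m)" for A \<omega>
  interpret \<nu>: sigma_finite_measure \<nu> by fact
  interpret p: sigma_finite_measure ?p by (rule sigma_finite_power_measure)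
  interpret m: sigma_finite_measure ?m by (rule sigma_finite_power_measure)
  interpret vp: pair_sigma_finite \<nu> ?p ..
  interpret vm: pair_sigma_finite \<nu> ?m ..
  have sp: "space \<nu> = space F"
    using sets_\<nu> by (rule sets_eq_imp_space_eq)
  have [measurable]: "\<rho> \<in> borel_measurable F"
    unfolding \<rho>_def by measurable
  have [measurable]: "I A \<in> borel_measurable F" if [measurable]: "A \<in> sets F" for A
    unfolding I_def by measurable
  \<comment> \<open>The substitution v -> u v cancels the dilation in the argument of
    \<open>f\<close>.\<close>
  have \<rho>_dil: "\<rho> (dil u \<omega>) = ennreal (u powr \<alpha>) * \<rho> \<omega>" if [measurable]: "\<omega> \<in> space F" and u: "u > 0" for u \<omega>
  proof -
    have "\<rho> (dil u \<omega>) = ennreal (u powr \<alpha>) * (\<integral>\<^sup>+ v. f (dil (1 / (u * v)) (dil u \<omega>)) \<partial>?p)"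
      unfolding \<rho>_def using u by (intro nn_integral_power_measure_scale) measurable
    also have "(\<integral>\<^sup>+ v. f (dil (1 / (u * v)) (dil u \<omega>)) \<partial>?p) = \<rho> \<omega>"
      unfolding \<rho>_def
    proof (rule nn_integral_cong_AE)
      show "AE v in ?p. f (dil (1 / (u * v)) (dil u \<omega>)) = f (dil (1 / v) \<omega>)"
        using AE_power_measure_pos by eventually_elim (use u in \<open>simp add: dil_dil\<close>)
    qed
    finally show ?thesis .
  qed
  \<comment> \<open>The measure now has exponent - \<alpha>, but the scaling rule is applied to the
    integral at \<open>\<omega>\<close> rather than at the dilated path; solving for the latter
    gives the factor with exponent \<alpha> again.\<close>
  have I_dil: "I A (dil u \<omega>) = ennreal (u powr \<alpha>) * I A \<omega>"
    if [measurable]: "\<omega> \<in> space F" "A \<in> sets F" and u: "u > 0" for u \<omega> A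
  proof -
    have "I A \<omega> = ennreal (u powr (- \<alpha>)) * (\<integral>\<^sup>+ v. indicator A (dil (u * v) \<omega>) \<partial>?m)"
      unfolding I_def using u by (intro nn_integral_power_measure_scale) measurable
    also have "(\<integral>\<^sup>+ v. indicator A (dil (u * v) \<omega>) \<partial>?m) = I A (dil u \<omega>)"
      unfolding I_def
    proof (rule nn_integral_cong_AE)
      show "AE v in ?m. indicator A (dil (u * v) \<omega>) = (indicator A (dil v (dil u \<omega>)) :: ennreal)"
        using AE_power_measure_pos by eventually_elim (use u in \<open>simp add: dil_dil mult.commute\<close>)
    qed
    finally have "ennreal (u powr \<alpha>) * I A \<omega> = (ennreal (u powr \<alpha>) * ennreal (u powr (- \<alpha>))) * I A (dil u \<omega>)"
      by (simp add: mult.assoc)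
    also have "ennreal (u powr \<alpha>) * ennreal (u powr (- \<alpha>)) = 1"
      using u by (simp add: ennreal_mult'[symmetric] powr_add[symmetric])
    finally show ?thesis by simp
  qed
  have inverse_mult_self: "inverse x * x = 1" if "0 < x" "x < \<infinity>" for x :: ennreal
    using that ennreal_divide_self[of x] by (simp add: divide_ennreal_def mult.commute)
  have key: "emeasure \<nu> A = (\<integral>\<^sup>+ \<omega>. f \<omega> * inverse (\<rho> \<omega>) * I A \<omega> \<partial>\<nu>)" if A [measurable]: "A \<in> sets F" for A
  proof -
    have inv_\<rho>: "inverse (\<rho> (dil v \<omega>)) = ennreal (v powr (- \<alpha>)) * inverse (\<rho> \<omega>)"
      if "\<omega> \<in> space F" "v > 0" for v \<omega>
      using that by (simp add: \<rho>_dil ennreal_inverse_mult' inverse_ennreal powr_minus)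
    have "emeasure \<nu> A = (\<integral>\<^sup>+ \<omega>. indicator A \<omega> \<partial>\<nu>)"
      using A by (simp add: sets_\<nu>)
    \<comment> \<open>The inserted product is 1 almost everywhere, where \<open>\<rho>\<close> is
      positive and finite. Unfolding \<open>\<rho>\<close> then creates a double integral in which,
      for each fixed \<open>v\<close>, homogeneity of \<open>\<nu>\<close> moves the dilation from
      \<open>f\<close> to the indicator.\<close>
    also have "\<dots> = (\<integral>\<^sup>+ \<omega>. indicator A \<omega> * inverse (\<rho> \<omega>) * \<rho> \<omega> \<partial>\<nu>)"
    proof (rule nn_integral_cong_AE)
      show "AE \<omega> in \<nu>. indicator A \<omega> = indicator A \<omega> * inverse (\<rho> \<omega>) * \<rho> \<omega>"
        using orbit unfolding \<rho>_def[symmetric]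
        by eventually_elim (simp add: mult.assoc inverse_mult_self)
    qed
    also have "\<dots> = (\<integral>\<^sup>+ \<omega>. (\<integral>\<^sup>+ v. indicator A \<omega> * inverse (\<rho> \<omega>) * f (dil (1 / v) \<omega>) \<partial>?p) \<partial>\<nu>)"
      by (intro nn_integral_cong) (simp add: nn_integral_cmult \<rho>_def sp)
    also have "\<dots> = (\<integral>\<^sup>+ v. (\<integral>\<^sup>+ \<omega>. indicator A \<omega> * inverse (\<rho> \<omega>) * f (dil (1 / v) \<omega>) \<partial>\<nu>) \<partial>?p)"
      by (rule vp.Fubini'[symmetric]) measurable
    \<comment> \<open>The exponent collects two factors \<open>v powr (- \<alpha>)\<close>: one from
      \<open>nn_integral_dil\<close> with dilation \<open>1 / v\<close>, one from the inverse of
      \<open>\<rho>\<close> at the path dilated by \<open>v\<close>.\<close>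
    also have "\<dots> = (\<integral>\<^sup>+ v. ennreal (v powr (- 2 * \<alpha>)) *
        (\<integral>\<^sup>+ \<omega>. f \<omega> * inverse (\<rho> \<omega>) * indicator A (dil v \<omega>) \<partial>\<nu>) \<partial>?p)"
    proof (rule nn_integral_cong_AE)
      show "AE v in ?p. (\<integral>\<^sup>+ \<omega>. indicator A \<omega> * inverse (\<rho> \<omega>) * f (dil (1 / v) \<omega>) \<partial>\<nu>) =
         ennreal (v powr (- 2 * \<alpha>)) * (\<integral>\<^sup>+ \<omega>. f \<omega> * inverse (\<rho> \<omega>) * indicator A (dil v \<omega>) \<partial>\<nu>)"
        using AE_power_measure_pos
      proof eventually_elim
        case (elim v)
        let ?\<Psi> = "\<lambda>\<omega>. indicator A (dil v \<omega>) * inverse (\<rho> (dil v \<omega>)) * f \<omega>"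
        have "(\<integral>\<^sup>+ \<omega>. indicator A \<omega> * inverse (\<rho> \<omega>) * f (dil (1 / v) \<omega>) \<partial>\<nu>) =
          (\<integral>\<^sup>+ \<omega>. ?\<Psi> (dil (1 / v) \<omega>) \<partial>\<nu>)"
          using elim by (simp add: dil_dil)
        also have "\<dots> = ennreal ((1 / v) powr \<alpha>) * (\<integral>\<^sup>+ \<omega>. ?\<Psi> \<omega> \<partial>\<nu>)"
          using elim sets_\<nu> hom by (intro nn_integral_dil) measurable
        also have "(\<integral>\<^sup>+ \<omega>. ?\<Psi> \<omega> \<partial>\<nu>) =
          (\<integral>\<^sup>+ \<omega>. ennreal (v powr (- \<alpha>)) * (f \<omega> * inverse (\<rho> \<omega>) * indicator A (dil v \<omega>)) \<partial>\<nu>)"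
          using elim by (intro nn_integral_cong) (simp add: inv_\<rho> sp mult_ac)
        also have "\<dots> = ennreal (v powr (- \<alpha>)) * (\<integral>\<^sup>+ \<omega>. f \<omega> * inverse (\<rho> \<omega>) * indicator A (dil v \<omega>) \<partial>\<nu>)"
          by (rule nn_integral_cmult) measurable
        also have "ennreal ((1 / v) powr \<alpha>) * (ennreal (v powr (- \<alpha>)) *
            (\<integral>\<^sup>+ \<omega>. f \<omega> * inverse (\<rho> \<omega>) * indicator A (dil v \<omega>) \<partial>\<nu>)) =
            ennreal ((1 / v) powr \<alpha> * v powr (- \<alpha>)) * (\<integral>\<^sup>+ \<omega>. f \<omega> * inverse (\<rho> \<omega>) * indicator A (dil v \<omega>) \<partial>\<nu>)"
          by (simp add: ennreal_mult' mult.assoc)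
        also have "(1 / v) powr \<alpha> * v powr (- \<alpha>) = v powr (- 2 * \<alpha>)"
          using elim by (simp add: powr_divide powr_minus divide_simps powr_add[symmetric])
        finally show ?case .
      qed
    qed
    \<comment> \<open>This factor changes the density exponent from \<alpha> - 1 to - \<alpha> - 1,
      so the weight of the orbit integral becomes the radial measure.\<close>
    also have "\<dots> = (\<integral>\<^sup>+ v. (\<integral>\<^sup>+ \<omega>. f \<omega> * inverse (\<rho> \<omega>) * indicator A (dil v \<omega>) \<partial>\<nu>) \<partial>?m)"
    proof -
      have *: "indicator {0<..} v * ennreal (\<alpha> * v powr (\<alpha> - 1)) * (ennreal (v powr (- 2 * \<alpha>)) * y) =
        indicator {0<..} v * ennreal (\<alpha> * v powr (- \<alpha> - 1)) * y" for v y
      proof -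
        have "\<alpha> * v powr (- \<alpha> - 1) = (\<alpha> * v powr (\<alpha> - 1)) * v powr (- 2 * \<alpha>)"
          by (simp only: mult.assoc powr_add[symmetric]) simp
        then have "ennreal (\<alpha> * v powr (- \<alpha> - 1)) = ennreal (\<alpha> * v powr (\<alpha> - 1)) * ennreal (v powr (- 2 * \<alpha>))"
          by (simp only: ennreal_mult''[OF powr_ge_zero])
        then show ?thesis by (simp add: mult.assoc)
      qed
      show ?thesis
        by (subst (1 2) nn_integral_power_measure, measurable, simp only: *)
    qed
    also have "\<dots> = (\<integral>\<^sup>+ \<omega>. (\<integral>\<^sup>+ v. f \<omega> * inverse (\<rho> \<omega>) * indicator A (dil v \<omega>) \<partial>?m) \<partial>\<nu>)"
      by (rule vm.Fubini') measurable
    also have "\<dots> = (\<integral>\<^sup>+ \<omega>. f \<omega> * inverse (\<rho> \<omega>) * I A \<omega> \<partial>\<nu>)"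
      by (intro nn_integral_cong) (simp add: nn_integral_cmult I_def sp)
    finally show ?thesis .
  qed
  define c where "c = (\<integral>\<^sup>+ \<omega>. f \<omega> \<partial>\<nu>)"
  \<comment> \<open>If \<open>c\<close> were 0, then \<open>f\<close> would vanish almost
    everywhere, and \<open>key\<close> for the whole space would make \<open>\<nu>\<close> the zero
    measure.\<close>
  have c_pos: "c > 0"
  proof (rule ccontr)
    assume "\<not> c > 0"
    then have "AE \<omega> in \<nu>. f \<omega> = 0"
      unfolding c_def by (simp add: nn_integral_0_iff_AE)
    then have "(\<integral>\<^sup>+ \<omega>. f \<omega> * inverse (\<rho> \<omega>) * I (space F) \<omega> \<partial>\<nu>) = (\<integral>\<^sup>+ \<omega>. 0 \<partial>\<nu>)"
      by (intro nn_integral_cong_AE) auto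
    then show False
      using key[of "space F"] nonzero by (simp add: sp)
  qed
  have c_fin: "c < \<infinity>"
    using f_int by (simp add: c_def)
  \<comment> \<open>Where \<open>\<rho>\<close> is 0 or infinite, a null set, \<open>r\<close> takes
    the value 0 and \<open>dil\<close> leaves the path unchanged.\<close>
  define r where "r \<omega> = enn2real (c / \<rho> \<omega>) powr (1 / \<alpha>)" for \<omega>
  have [measurable]: "r \<in> borel_measurable F"
    unfolding r_def by measurable
  have r: "r \<omega> > 0 \<and> ennreal (r \<omega> powr \<alpha>) = c / \<rho> \<omega>" if "0 < \<rho> \<omega>" "\<rho> \<omega> < \<infinity>" for \<omega>
  proof -
    have "0 < c / \<rho> \<omega>" "c / \<rho> \<omega> \<noteq> top"
      using that c_pos c_fin
      by (auto simp: ennreal_zero_less_divide ennreal_divide_eq_top_iff)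
    then have "0 < c / \<rho> \<omega>" "c / \<rho> \<omega> < top"
      by (simp_all add: top.not_eq_extremum)
    then have "0 < enn2real (c / \<rho> \<omega>)" "ennreal (enn2real (c / \<rho> \<omega>)) = c / \<rho> \<omega>"
      by (auto simp: enn2real_positive_iff)
    then show ?thesis
      using \<alpha> by (simp add: r_def powr_powr)
  qed
  define Q where "Q = distr (density \<nu> (\<lambda>\<omega>. f \<omega> / c)) F (\<lambda>\<omega>. dil (r \<omega>) \<omega>)"
  have Q_int: "(\<integral>\<^sup>+ \<omega>. \<Phi> \<omega> \<partial>Q) = (\<integral>\<^sup>+ \<omega>. f \<omega> / c * \<Phi> (dil (r \<omega>) \<omega>) \<partial>\<nu>)"
    if [measurable]: "\<Phi> \<in> borel_measurable F" for \<Phi>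
    unfolding Q_def by (subst nn_integral_distr, measurable, subst nn_integral_density) auto
  have "spectral_representation cmul F \<alpha> \<nu> Q"
    unfolding spectral_representation_iff[OF \<alpha>]
  proof (intro conjI ballI)
    show sQ: "sets Q = sets F"
      by (simp add: Q_def)
    have "emeasure Q (space Q) = (\<integral>\<^sup>+ \<omega>. 1 \<partial>Q)"
      by simp
    also have "\<dots> = (\<integral>\<^sup>+ \<omega>. f \<omega> / c \<partial>\<nu>)"
      by (subst Q_int) auto
    also have "\<dots> = c / c"
      unfolding c_def by (rule nn_integral_divide) measurable
    also have "\<dots> = 1"
      using c_pos c_fin by (intro ennreal_divide_self) auto
    finally show "prob_space Q"
      by (rule prob_spaceI)
  next
    fix A assume [measurable]: "A \<in> sets F"
    have "emeasure \<nu> A = (\<integral>\<^sup>+ \<omega>. f \<omega> * inverse (\<rho> \<omega>) * I A \<omega> \<partial>\<nu>)"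
      by (rule key) measurable
    also have "\<dots> = (\<integral>\<^sup>+ \<omega>. f \<omega> / c * I A (dil (r \<omega>) \<omega>) \<partial>\<nu>)"
    proof (rule nn_integral_cong_AE)
      show "AE \<omega> in \<nu>. f \<omega> * inverse (\<rho> \<omega>) * I A \<omega> = f \<omega> / c * I A (dil (r \<omega>) \<omega>)"
        using orbit AE_space unfolding \<rho>_def[symmetric]
      proof eventually_elim
        case (elim \<omega>)
        then have "I A (dil (r \<omega>) \<omega>) = c / \<rho> \<omega> * I A \<omega>"
          using I_dil[of \<omega> A "r \<omega>"] r[of \<omega>] by (simp add: sp)
        moreover have "inverse c * c = 1"
          using c_pos c_fin by (simp add: inverse_mult_self)
        ultimately show ?case
          by (simp add: divide_ennreal_def mult_ac) (simp add: mult.assoc[symmetric])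
      qed
    qed
    also have "\<dots> = (\<integral>\<^sup>+ \<omega>. I A \<omega> \<partial>Q)"
      by (subst Q_int) auto
    finally show "emeasure \<nu> A = (\<integral>\<^sup>+ \<omega>. (\<integral>\<^sup>+ u. indicator A (dil u \<omega>) \<partial>?m) \<partial>Q)"
      by (simp add: I_def)
  qed
  then show ?thesis ..
qed

section \<open>Construction of the integrable function from a finite measure\<close>

lemma spectral_representation_exists_if_finite_measure:
  assumes \<alpha>: "\<alpha> > 0" and sets_\<nu> [measurable_cong]: "sets \<nu> = sets F"
    and hom: "\<And>u A. u > 0 \<Longrightarrow> A \<in> sets F \<Longrightarrow>
      emeasure \<nu> {\<omega> \<in> space F. dilate cmul u \<omega> \<in> A} = ennreal (u powr \<alpha>) * emeasure \<nu> A"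
    and nonzero: "emeasure \<nu> (space \<nu>) \<noteq> 0"
    and fin: "finite_measure \<mu>" and sets_\<mu> [measurable_cong]: "sets \<mu> = sets borel"
    and exceed: "(\<integral>\<^sup>+ \<omega>. emeasure \<mu> {s. nrm (\<omega> s) > 1} \<partial>\<nu>) < \<infinity>"
    and pos: "AE \<omega> in \<nu>. emeasure \<mu> {s. nrm (\<omega> s) > 0} > 0"
  shows "\<exists>Q. spectral_representation cmul F \<alpha> \<nu> Q"
proof -
  interpret \<mu>: finite_measure \<mu> by fact
  have sp: "space \<nu> = space F" and sp_\<mu> [simp]: "space \<mu> = UNIV"
    using sets_eq_imp_space_eq[OF sets_\<nu>] sets_eq_imp_space_eq[OF sets_\<mu>] by auto
  \<comment> \<open>The tail function of the norm under \<open>\<mu>\<close>: dilation merely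
    rescales its argument. Since \<open>\<mu>\<close> is finite and the norm is real-valued, it
    decreases to 0 at infinity; as \<open>v\<close> decreases to 0 it increases to
    \<open>b \<omega> 0\<close>.\<close>
  define b where "b \<omega> v = measure \<mu> {s. nrm (\<omega> s) > v}" for \<omega> v
  have b_measurable [measurable]: "(\<lambda>\<omega>. b \<omega> v) \<in> borel_measurable F" for v
  proof -
    have "(\<lambda>\<omega>. emeasure \<mu> {s. nrm (\<omega> s) > v}) \<in> borel_measurable F"
      by (rule \<mu>.measurable_emeasure) measurable
    then show ?thesis
      unfolding b_def measure_def by measurable
  qed
  have sets_b [measurable]: "{s. nrm (\<omega> s) > v} \<in> sets borel" if [measurable]: "\<omega> \<in> space F" for \<omega> v
    by measurable
  have b_dil: "b (dil u \<omega>) v = b \<omega> (v / u)" if "u > 0" for u \<omega> v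
    using that by (simp add: b_def nrm_dil field_simps)
  have b_mono: "b \<omega> w \<le> b \<omega> v" if "\<omega> \<in> space F" "v \<le> w" for \<omega> v w
    unfolding b_def using that by (intro \<mu>.finite_measure_mono) auto
  have b_nonneg: "b \<omega> v \<ge> 0" for \<omega> v
    by (simp add: b_def)
  have b_infinity: "(\<lambda>n. b \<omega> (real (Suc n))) \<longlonglongrightarrow> 0" if "\<omega> \<in> space F" for \<omega>
  proof -
    have "(\<lambda>n. measure \<mu> {s. nrm (\<omega> s) > real (Suc n)}) \<longlonglongrightarrow> measure \<mu> (\<Inter>n. {s. nrm (\<omega> s) > real (Suc n)})"
      using that by (intro \<mu>.finite_Lim_measure_decseq) (auto simp: decseq_def)
    also have "(\<Inter>n. {s. nrm (\<omega> s) > real (Suc n)}) = {}"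
    proof -
      have "\<exists>n. nrm (\<omega> s) \<le> real (Suc n)" for s
        using real_arch_simple[of "nrm (\<omega> s)"] by (metis le_SucI of_nat_le_iff order_refl order_trans)
      then show ?thesis by (auto simp: set_eq_iff not_less simp del: of_nat_Suc)
    qed
    finally show ?thesis by (simp add: b_def)
  qed
  have b_zero: "(\<lambda>n. b \<omega> (1 / real (Suc n))) \<longlonglongrightarrow> b \<omega> 0" if "\<omega> \<in> space F" for \<omega>
  proof -
    have "(\<lambda>n. measure \<mu> {s. nrm (\<omega> s) > 1 / real (Suc n)}) \<longlonglongrightarrow>
        measure \<mu> (\<Union>n. {s. nrm (\<omega> s) > 1 / real (Suc n)})"
    proof (rule \<mu>.finite_Lim_measure_incseq)
      show "incseq (\<lambda>n. {s. nrm (\<omega> s) > 1 / real (Suc n)})"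
        by (auto simp: incseq_def elim!: le_less_trans[rotated] intro!: divide_left_mono)
    qed (use that in auto)
    also have "(\<Union>n. {s. nrm (\<omega> s) > 1 / real (Suc n)}) = {s. nrm (\<omega> s) > 0}"
    proof -
      have "\<exists>n. nrm (\<omega> s) > 1 / real (Suc n)" if "nrm (\<omega> s) > 0" for s
        using reals_Archimedean[OF that] by (simp add: inverse_eq_divide)
      moreover have "nrm (\<omega> s) > 0" if "nrm (\<omega> s) > 1 / real (Suc n)" for s n
        using that by (rule le_less_trans[rotated]) simp
      ultimately show ?thesis by auto
    qed
    finally show ?thesis by (simp add: b_def)
  qed
  have pos': "AE \<omega> in \<nu>. b \<omega> 0 > 0"
    using pos by eventually_elim (simp add: b_def \<mu>.emeasure_eq_measure)
  have b_int: "(\<integral>\<^sup>+ \<omega>. ennreal (b \<omega> 1) \<partial>\<nu>) < \<infinity>"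
    using exceed by (simp add: b_def \<mu>.emeasure_eq_measure)

  have "sigma_finite_measure \<nu>"
  proof
    \<comment> \<open>Dilation by \<open>Suc k\<close> turns \<open>A k\<close> into a condition on
      \<open>b \<omega> 1\<close>. Markov's inequality bounds the measure of that condition, and
      homogeneity carries the bound back to \<open>A k\<close>. The null set \<open>N\<close>
      collects the paths that no \<open>A k\<close> needs to cover.\<close>
    define A where "A k = {\<omega> \<in> space F. b \<omega> (1 / real (Suc k)) > 1 / real (Suc k)}" for k
    define N where "N = {\<omega> \<in> space F. \<not> b \<omega> 0 > 0}"
    have [measurable]: "A k \<in> sets F" "N \<in> sets F" for k
      unfolding A_def N_def by measurable
    have "emeasure \<nu> N = 0"
      using pos' by (subst (asm) AE_iff_measurable[of N]) (auto simp: N_def sp sets_\<nu>)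
    moreover have "emeasure \<nu> (A k) \<noteq> \<infinity>" for k
    proof -
      let ?A = "{\<omega> \<in> space F. b \<omega> 1 > 1 / real (Suc k)}"
      have "emeasure \<nu> ?A \<le> emeasure \<nu> {\<omega> \<in> space \<nu>. 1 \<le> ennreal (real (Suc k)) * ennreal (b \<omega> 1)}"
      proof (rule emeasure_mono)
        have "1 \<le> ennreal (real (Suc k)) * ennreal x" if "1 / real (Suc k) < x" for x
        proof -
          have "1 \<le> real (Suc k) * x"
            using that by (simp add: field_simps)
          then have "ennreal 1 \<le> ennreal (real (Suc k) * x)"
            by (rule ennreal_leI)
          then show ?thesis
            by (simp add: ennreal_mult')
        qed
        then show "?A \<subseteq> {\<omega> \<in> space \<nu>. 1 \<le> ennreal (real (Suc k)) * ennreal (b \<omega> 1)}"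
          by (auto simp: sp)
      qed measurable
      also have "\<dots> \<le> ennreal (real (Suc k)) * (\<integral>\<^sup>+ \<omega>. ennreal (b \<omega> 1) * indicator (space \<nu>) \<omega> \<partial>\<nu>)"
        using nn_integral_Markov_inequality[of "\<lambda>\<omega>. ennreal (b \<omega> 1)" "space \<nu>" \<nu> "ennreal (real (Suc k))"]
        by (simp del: of_nat_Suc)
      also have "(\<integral>\<^sup>+ \<omega>. ennreal (b \<omega> 1) * indicator (space \<nu>) \<omega> \<partial>\<nu>) = (\<integral>\<^sup>+ \<omega>. ennreal (b \<omega> 1) \<partial>\<nu>)"
        by (intro nn_integral_cong) simp
      also have "ennreal (real (Suc k)) * \<dots> < \<infinity>"
        using b_int by (simp add: ennreal_mult_less_top)
      finally have "emeasure \<nu> ?A < \<infinity>" .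
      moreover have "A k = {\<omega> \<in> space F. dilate cmul (real (Suc k)) \<omega> \<in> ?A}"
        using b_dil[of "real (Suc k)" _ 1] by (auto simp: A_def dilate_closed dil_eq)
      moreover have "?A \<in> sets F" by measurable
      ultimately show ?thesis
        using hom[of "real (Suc k)" ?A] by (simp add: ennreal_mult_eq_top_iff)
    qed
    moreover have "space F \<subseteq> N \<union> (\<Union>k. A k)"
    proof
      fix \<omega> assume \<omega>: "\<omega> \<in> space F"
      show "\<omega> \<in> N \<union> (\<Union>k. A k)"
      proof (cases "b \<omega> 0 > 0")
        case True
        \<comment> \<open>The level and the threshold shrink together: the tail tends to the
          positive number \<open>b \<omega> 0\<close> while the threshold tends to 0, so
          \<open>\<omega>\<close> lies in some \<open>A k\<close>.\<close>
        have "(\<lambda>n. b \<omega> (1 / real (Suc n)) - 1 / real (Suc n)) \<longlonglongrightarrow> b \<omega> 0 - 0"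
          by (intro tendsto_diff b_zero[OF \<omega>] LIMSEQ_Suc[OF lim_1_over_n])
        then have "eventually (\<lambda>n. b \<omega> (1 / real (Suc n)) - 1 / real (Suc n) > 0) sequentially"
          using True by (intro order_tendstoD) simp_all
        then show ?thesis
          using \<omega> by (auto simp: A_def eventually_sequentially)
      qed (use \<omega> in \<open>auto simp: N_def\<close>)
    qed
    ultimately show "\<exists>A. countable A \<and> A \<subseteq> sets \<nu> \<and> \<Union> A = space \<nu> \<and> (\<forall>a\<in>A. emeasure \<nu> a \<noteq> \<infinity>)"
      by (intro exI[of _ "insert N (range A)"]) (auto simp: sets_\<nu> sp A_def N_def)
  qed

  \<comment> \<open>The threshold is relative to the \<open>0\<close>-homogeneous quantity \<open>b \<omega> 0\<close>, so \<open>f (\<omega> / v)\<close> vanishes for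
    large \<open>v\<close> and is positive for small \<open>v\<close>; the factor \<open>b \<omega> 0\<close> yields \<open>f \<omega> \<le> 2 * b \<omega> 1\<close>.\<close>
  define f where "f \<omega> = ennreal (if 2 * b \<omega> 1 > b \<omega> 0 then b \<omega> 0 else 0)" for \<omega>
  have f_dil: "f (dil (1 / v) \<omega>) = ennreal (if 2 * b \<omega> v > b \<omega> 0 then b \<omega> 0 else 0)" if "v > 0" for v \<omega>
    using that by (simp add: f_def b_dil)
  \<comment> \<open>The tail falls from \<open>b \<omega> 0\<close> to 0, so half its initial value
    is exceeded for small \<open>v\<close> and no longer for large \<open>v\<close>. Hence the
    integrand equals \<open>b \<omega> 0\<close> on some interval starting at 0 and is 0 beyond a
    larger one, and both intervals have positive finite mass.\<close>
  have orbit: "0 < (\<integral>\<^sup>+ v. f (dil (1 / v) \<omega>) \<partial>power_measure \<alpha> \<alpha>) \<and>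
      (\<integral>\<^sup>+ v. f (dil (1 / v) \<omega>) \<partial>power_measure \<alpha> \<alpha>) < \<infinity>"
    if \<omega>: "\<omega> \<in> space F" and M: "b \<omega> 0 > 0" for \<omega>
  proof
    have "eventually (\<lambda>n. b \<omega> (1 / real (Suc n)) > b \<omega> 0 / 2) sequentially"
      using M by (intro order_tendstoD(1)[OF b_zero[OF \<omega>]]) simp
    then obtain n where n: "b \<omega> (1 / real (Suc n)) > b \<omega> 0 / 2"
      by (auto simp: eventually_sequentially)
    have "0 < ennreal (b \<omega> 0) * emeasure (power_measure \<alpha> \<alpha>) {0<..1 / real (Suc n)}"
      using M \<alpha> by (subst emeasure_power_measure_Ioc) (auto simp: ennreal_zero_less_mult_iff)
    also have "\<dots> = (\<integral>\<^sup>+ v. ennreal (b \<omega> 0) * indicator {0<..1 / real (Suc n)} v \<partial>power_measure \<alpha> \<alpha>)"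
      by (subst nn_integral_cmult_indicator) auto
    also have "\<dots> \<le> (\<integral>\<^sup>+ v. f (dil (1 / v) \<omega>) \<partial>power_measure \<alpha> \<alpha>)"
    proof (rule nn_integral_mono)
      fix v
      show "ennreal (b \<omega> 0) * indicator {0<..1 / real (Suc n)} v \<le> f (dil (1 / v) \<omega>)"
        using n b_mono[OF \<omega>, of v "1 / real (Suc n)"] by (auto simp: f_dil indicator_def)
    qed
    finally show "0 < (\<integral>\<^sup>+ v. f (dil (1 / v) \<omega>) \<partial>power_measure \<alpha> \<alpha>)" .
  next
    have "eventually (\<lambda>n. b \<omega> (real (Suc n)) < b \<omega> 0 / 2) sequentially"
      using M by (intro order_tendstoD(2)[OF b_infinity[OF \<omega>]]) simp
    then obtain n where n: "b \<omega> (real (Suc n)) < b \<omega> 0 / 2"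
      by (auto simp: eventually_sequentially)
    have "(\<integral>\<^sup>+ v. f (dil (1 / v) \<omega>) \<partial>power_measure \<alpha> \<alpha>) \<le>
      (\<integral>\<^sup>+ v. ennreal (b \<omega> 0) * indicator {0<..real (Suc n)} v \<partial>power_measure \<alpha> \<alpha>)"
    proof (rule nn_integral_mono_AE)
      show "AE v in power_measure \<alpha> \<alpha>. f (dil (1 / v) \<omega>) \<le> ennreal (b \<omega> 0) * indicator {0<..real (Suc n)} v"
        using AE_power_measure_pos
      proof eventually_elim
        case (elim v)
        then show ?case
          using n b_mono[OF \<omega>, of "real (Suc n)" v] by (auto simp: f_dil indicator_def)
      qed
    qed
    also have "\<dots> = ennreal (b \<omega> 0) * emeasure (power_measure \<alpha> \<alpha>) {0<..real (Suc n)}"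
      by (subst nn_integral_cmult_indicator) auto
    also have "\<dots> < \<infinity>"
      using \<alpha> by (subst emeasure_power_measure_Ioc) (auto simp: ennreal_mult_less_top)
    finally show "(\<integral>\<^sup>+ v. f (dil (1 / v) \<omega>) \<partial>power_measure \<alpha> \<alpha>) < \<infinity>" .
  qed
  have "AE \<omega> in \<nu>. 0 < (\<integral>\<^sup>+ v. f (dil (1 / v) \<omega>) \<partial>power_measure \<alpha> \<alpha>) \<and>
      (\<integral>\<^sup>+ v. f (dil (1 / v) \<omega>) \<partial>power_measure \<alpha> \<alpha>) < \<infinity>"
    using AE_space[of \<nu>] pos' unfolding sp by eventually_elim (rule orbit)
  moreover have "(\<integral>\<^sup>+ \<omega>. f \<omega> \<partial>\<nu>) < \<infinity>"
  proof -
    have "(\<integral>\<^sup>+ \<omega>. f \<omega> \<partial>\<nu>) \<le> (\<integral>\<^sup>+ \<omega>. 2 * ennreal (b \<omega> 1) \<partial>\<nu>)"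
    proof (rule nn_integral_mono)
      fix \<omega>
      have "f \<omega> \<le> ennreal (2 * b \<omega> 1)"
        unfolding f_def using b_nonneg[of \<omega> 1] by (intro ennreal_leI) auto
      then show "f \<omega> \<le> 2 * ennreal (b \<omega> 1)"
        using b_nonneg[of \<omega> 1] by (simp add: ennreal_mult')
    qed
    also have "\<dots> = 2 * (\<integral>\<^sup>+ \<omega>. ennreal (b \<omega> 1) \<partial>\<nu>)"
      by (rule nn_integral_cmult) measurable
    also have "\<dots> < \<infinity>"
      using b_int by (simp add: ennreal_mult_less_top)
    finally show ?thesis .
  qed
  moreover have "f \<in> borel_measurable F"
    unfolding f_def by measurable
  ultimately show ?thesis
    using \<open>sigma_finite_measure \<nu>\<close> \<alpha> sets_\<nu> hom nonzero
    by (intro spectral_representation_exists_if_orbit_integrable)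
qed

section \<open>Shifts under stationarity\<close>

lemma nn_integral_shift_by:
  assumes [measurable_cong]: "sets \<nu> = sets F" and stat: "stationary \<nu>"
    and [measurable]: "\<Phi> \<in> borel_measurable F"
  shows "(\<integral>\<^sup>+ \<omega>. \<Phi> (shift_by s \<omega>) \<partial>\<nu>) = (\<integral>\<^sup>+ \<omega>. \<Phi> \<omega> \<partial>\<nu>)"
proof -
  have "distr \<nu> F (shift_by s) = \<nu>"
  proof (rule measure_eqI)
    fix A assume "A \<in> sets (distr \<nu> F (shift_by s))"
    then have [measurable]: "A \<in> sets F" by simp
    have "emeasure (distr \<nu> F (shift_by s)) A = emeasure \<nu> (shift_by s -` A \<inter> space \<nu>)"
      by (rule emeasure_distr) measurable
    also have "shift_by s -` A \<inter> space \<nu> = {\<omega> \<in> space \<nu>. shift_by s \<omega> \<in> A}"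
      by auto
    finally show "emeasure (distr \<nu> F (shift_by s)) A = emeasure \<nu> A"
      using stat by (simp add: stationary_def assms)
  qed (simp add: assms)
  moreover have "(\<integral>\<^sup>+ \<omega>. \<Phi> (shift_by s \<omega>) \<partial>\<nu>) = (\<integral>\<^sup>+ \<omega>. \<Phi> \<omega> \<partial>distr \<nu> F (shift_by s))"
    by (subst nn_integral_distr) measurable
  ultimately show ?thesis by simp
qed

text \<open>\<open>Q\<close> itself need not be shift-invariant, so the weighted expectation is
  first rewritten under \<open>\<nu>\<close>, where stationarity moves the exceedance from
  \<open>s\<close> to 0, and is then rewritten back. The second rewriting is legitimate because
  shifts commute with dilations, so the shifted \<open>G\<close> is still 0-homogeneous.\<close>

lemma nn_integral_spectral_shift:
  assumes \<alpha>: "\<alpha> > 0" and rep: "spectral_representation cmul F \<alpha> \<nu> Q"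
    and sets_\<nu> [measurable_cong]: "sets \<nu> = sets F" and stat: "stationary \<nu>"
    and G [measurable]: "G \<in> borel_measurable F"
    and hom: "\<And>\<omega> u. \<omega> \<in> space F \<Longrightarrow> u > 0 \<Longrightarrow> G (dilate cmul u \<omega>) = (G \<omega> :: ennreal)"
  shows "(\<integral>\<^sup>+ \<omega>. G \<omega> * ennreal (nrm (\<omega> s) powr \<alpha>) \<partial>Q) =
    (\<integral>\<^sup>+ \<omega>. G (shift_by (- s) \<omega>) * ennreal (nrm (\<omega> 0) powr \<alpha>) \<partial>Q)"
proof -
  have [measurable]: "Measurable.pred F (\<lambda>\<omega>. nrm (\<omega> 0) > 1)"
    by measurable
  have "(\<integral>\<^sup>+ \<omega>. G \<omega> * ennreal (nrm (\<omega> s) powr \<alpha>) \<partial>Q) =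
    (\<integral>\<^sup>+ \<omega>. G \<omega> * indicator {\<omega>. nrm (\<omega> s) > 1} \<omega> \<partial>\<nu>)"
    using \<alpha> rep sets_\<nu> G hom by (rule nn_integral_spectral_homogeneous)
  also have "\<dots> = (\<integral>\<^sup>+ \<omega>. G (shift_by (- s) (shift_by s \<omega>)) *
      indicator {\<omega>. nrm (\<omega> 0) > 1} (shift_by s \<omega>) \<partial>\<nu>)"
    by (simp add: shift_by_def indicator_def add.assoc)
  also have "\<dots> = (\<integral>\<^sup>+ \<omega>. G (shift_by (- s) \<omega>) * indicator {\<omega>. nrm (\<omega> 0) > 1} \<omega> \<partial>\<nu>)"
    using sets_\<nu> stat by (rule nn_integral_shift_by) measurable
  also have "\<dots> = (\<integral>\<^sup>+ \<omega>. G (shift_by (- s) \<omega>) * ennreal (nrm (\<omega> 0) powr \<alpha>) \<partial>Q)"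
  proof (rule nn_integral_spectral_homogeneous[OF \<alpha> rep sets_\<nu>, symmetric])
    fix \<omega> and u :: real assume "\<omega> \<in> space F" "u > 0"
    then show "G (shift_by (- s) (dilate cmul u \<omega>)) = G (shift_by (- s) \<omega>)"
      using shift_dil[of "- s" u \<omega>] by (simp add: dil_eq hom shift_closed)
  qed measurable
  finally show ?thesis .
qed

section \<open>Choice of the finite measure\<close>

text \<open>The reference measure is cut into countably many compact pieces, each with finite mass
  and finite expected exceedance. Weighting the pieces makes both quantities summable without
  creating new null sets.\<close>

lemma spectral_representation_exists:
  assumes \<sigma>: "sigma_compact_space (euclidean :: 'g topology)"
    and sigma_finite: "sigma_finite_measure lam" and sets_lam [measurable_cong]: "sets lam = sets borel"
    and lam_compact: "\<And>K. compact K \<Longrightarrow> emeasure lam K < \<infinity>"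
    and tail: "tail_measure lam cmul nrm F \<alpha> \<nu>" and nonzero: "emeasure \<nu> (space \<nu>) \<noteq> 0"
  shows "\<exists>Q. spectral_representation cmul F \<alpha> \<nu> Q"
proof -
  interpret lam: sigma_finite_measure lam by fact
  from tail have \<alpha>: "\<alpha> > 0" and sets_\<nu> [measurable_cong]: "sets \<nu> = sets F"
    and pos: "AE \<omega> in \<nu>. (\<integral>\<^sup>+ s. indicator {s. nrm (\<omega> s) > 0} s \<partial>lam) > 0"
    and exceed: "\<And>B. compact B \<Longrightarrow> (\<integral>\<^sup>+ \<omega>. exceedance lam nrm \<omega> B \<partial>\<nu>) < \<infinity>"
    and hom: "\<And>u A. u > 0 \<Longrightarrow> A \<in> sets F \<Longrightarrow>
      emeasure \<nu> {\<omega> \<in> space F. dilate cmul u \<omega> \<in> A} = ennreal (u powr \<alpha>) * emeasure \<nu> A"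
    by (auto simp: tail_measure_def)
  have sp: "space \<nu> = space F" and sp_lam [simp]: "space lam = UNIV"
    using sets_eq_imp_space_eq[OF sets_\<nu>] sets_eq_imp_space_eq[OF sets_lam] by auto
  have sets_b [measurable]: "{s. nrm (\<omega> s) > v} \<in> sets borel" if [measurable]: "\<omega> \<in> space F" for \<omega> v
    by measurable
  obtain \<K> :: "'g set set" where \<K>: "countable \<K>" "\<And>K. K \<in> \<K> \<Longrightarrow> compact K" "\<Union>\<K> = UNIV"
    using \<sigma> by (auto simp: sigma_compact_space_def)
  then have "\<K> \<noteq> {}" by auto
  \<comment> \<open>The enumeration may repeat sets, so a finite cover requires no separate case;
    overlaps only add weight.\<close>
  define B where "B = from_nat_into \<K>"
  have B: "compact (B n)" for n
    unfolding B_def using \<open>\<K> \<noteq> {}\<close> by (intro \<K> from_nat_into)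
  have B_Un: "(\<Union>n. B n) = UNIV"
    using \<K> \<open>\<K> \<noteq> {}\<close> range_from_nat_into[of \<K>] by (simp add: B_def)
  have B_sets [measurable]: "B n \<in> sets borel" for n
    by (intro borel_compact B)
  define x where "x n = emeasure lam (B n) + (\<integral>\<^sup>+ \<omega>. exceedance lam nrm \<omega> (B n) \<partial>\<nu>)" for n
  \<comment> \<open>Adding 1 avoids division by zero, and \<open>x n\<close> is finite, so its real
    value loses nothing. The geometric factor makes the weighted pieces summable.\<close>
  define a where "a n = ennreal ((1 / 2) ^ Suc n / (1 + enn2real (x n)))" for n
  have a_pos: "a n > 0" for n
    by (simp add: a_def add_pos_nonneg)
  \<comment> \<open>Stated for every \<open>y\<close> below \<open>x n\<close>, since it serves both
    summands of \<open>x n\<close>: the mass of the piece and its expected exceedance.\<close>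
  have a_le: "a n * y \<le> ennreal ((1 / 2) ^ Suc n)" if "y \<le> x n" for n y
  proof -
    have "x n < top"
      using lam_compact[OF B] exceed[OF B] by (simp add: x_def)
    then have "a n * y \<le> a n * ennreal (enn2real (x n))"
      using that by (intro mult_left_mono) simp_all
    also have "\<dots> = ennreal ((1 / 2) ^ Suc n * (enn2real (x n) / (1 + enn2real (x n))))"
      by (simp add: a_def ennreal_mult''[symmetric])
    also have "\<dots> \<le> ennreal ((1 / 2) ^ Suc n * 1)"
    proof (intro ennreal_leI mult_left_mono)
      have "1 + enn2real (x n) > 0"
        by (simp add: add_pos_nonneg)
      then show "enn2real (x n) / (1 + enn2real (x n)) \<le> 1"
        by (simp add: divide_le_eq_1)
    qed simp
    finally show ?thesis by simp
  qed
  have geom: "(\<Sum>n. ennreal ((1 / 2) ^ Suc n)) < \<infinity>"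
    using power_half_series by (subst suminf_ennreal_eq) auto
  define \<mu> where "\<mu> = density lam (\<lambda>s. \<Sum>n. a n * indicator (B n) s)"
  have sets_\<mu>: "sets \<mu> = sets borel"
    by (simp add: \<mu>_def sets_lam)
  have \<mu>_emeasure: "emeasure \<mu> S = (\<Sum>n. a n * emeasure lam (B n \<inter> S))"
    if [measurable]: "S \<in> sets borel" for S
  proof -
    have "emeasure \<mu> S = (\<integral>\<^sup>+ s. (\<Sum>n. a n * indicator (B n) s) * indicator S s \<partial>lam)"
      unfolding \<mu>_def by (rule emeasure_density) (auto simp: sets_lam)
    also have "\<dots> = (\<integral>\<^sup>+ s. (\<Sum>n. a n * indicator (B n \<inter> S) s) \<partial>lam)"
      by (intro nn_integral_cong) (simp add: indicator_inter_arith mult.assoc[symmetric])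
    also have "\<dots> = (\<Sum>n. a n * emeasure lam (B n \<inter> S))"
      by (subst nn_integral_suminf) (auto simp: nn_integral_cmult_indicator sets_lam)
    finally show ?thesis .
  qed
  have "finite_measure \<mu>"
  proof
    have "emeasure \<mu> (space \<mu>) = (\<Sum>n. a n * emeasure lam (B n))"
      using \<mu>_emeasure[of UNIV] by (simp add: \<mu>_def)
    also have "\<dots> \<le> (\<Sum>n. ennreal ((1 / 2) ^ Suc n))"
      by (intro suminf_le a_le) (auto simp: x_def)
    finally have "emeasure \<mu> (space \<mu>) < \<infinity>"
      using geom by (rule le_less_trans)
    then show "emeasure \<mu> (space \<mu>) \<noteq> \<infinity>"
      by simp
  qed
  moreover have "(\<integral>\<^sup>+ \<omega>. emeasure \<mu> {s. nrm (\<omega> s) > 1} \<partial>\<nu>) < \<infinity>"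
  proof -
    have [measurable]: "(\<lambda>\<omega>. exceedance lam nrm \<omega> (B n)) \<in> borel_measurable F" for n
      unfolding exceedance_def by measurable
    have "(\<integral>\<^sup>+ \<omega>. emeasure \<mu> {s. nrm (\<omega> s) > 1} \<partial>\<nu>) = (\<integral>\<^sup>+ \<omega>. (\<Sum>n. a n * exceedance lam nrm \<omega> (B n)) \<partial>\<nu>)"
    proof (rule nn_integral_cong)
      fix \<omega> assume "\<omega> \<in> space \<nu>"
      then have [measurable]: "\<omega> \<in> space F" by (simp add: sp)
      have "exceedance lam nrm \<omega> (B n) = emeasure lam (B n \<inter> {s. nrm (\<omega> s) > 1})" for n
        unfolding exceedance_def indicator_inter_arith[symmetric]
        by (rule nn_integral_indicator) (simp add: sets_lam)
      then show "emeasure \<mu> {s. nrm (\<omega> s) > 1} = (\<Sum>n. a n * exceedance lam nrm \<omega> (B n))"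
        by (simp add: \<mu>_emeasure)
    qed
    also have "\<dots> = (\<Sum>n. a n * (\<integral>\<^sup>+ \<omega>. exceedance lam nrm \<omega> (B n) \<partial>\<nu>))"
      by (subst nn_integral_suminf) (auto simp: nn_integral_cmult)
    also have "\<dots> \<le> (\<Sum>n. ennreal ((1 / 2) ^ Suc n))"
      by (intro suminf_le a_le) (auto simp: x_def)
    finally show ?thesis
      using geom by (rule le_less_trans)
  qed
  \<comment> \<open>As every \<open>a n\<close> is positive, a \<open>\<mu>\<close>-null set meets
    each \<open>B n\<close> in a \<open>lam\<close>-null set; the pieces cover the group, so it is
    \<open>lam\<close>-null.\<close>
  moreover have "AE \<omega> in \<nu>. emeasure \<mu> {s. nrm (\<omega> s) > 0} > 0"
    using pos AE_space
  proof eventually_elim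
    case (elim \<omega>)
    then have [measurable]: "\<omega> \<in> space F" by (simp add: sp)
    let ?S = "{s. nrm (\<omega> s) > 0}"
    show ?case
    proof (rule ccontr)
      assume "\<not> ?thesis"
      then have "(\<Sum>n. a n * emeasure lam (B n \<inter> ?S)) = 0"
        by (simp add: \<mu>_emeasure)
      then have "emeasure lam (B n \<inter> ?S) = 0" for n
        using a_pos[of n] by (simp add: suminf_eq_zero_iff) (metis less_irrefl)
      then have "emeasure lam (\<Union>n. B n \<inter> ?S) = 0"
        by (intro emeasure_UN_eq_0) (auto simp: sets_lam)
      moreover have "(\<Union>n. B n \<inter> ?S) = ?S"
        using B_Un by auto
      moreover have "(\<integral>\<^sup>+ s. indicator ?S s \<partial>lam) = emeasure lam ?S"
        by (rule nn_integral_indicator) (simp add: sets_lam)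
      ultimately show False
        using elim by simp
    qed
  qed
  ultimately show ?thesis
    using \<alpha> sets_\<nu> hom nonzero sets_\<mu> by (intro spectral_representation_exists_if_finite_measure)
qed

end

section \<open>Sigma-finiteness of Haar measure and the final assembly\<close>

text \<open>The compact pieces of the cover have finite mass. Sigma-finiteness licenses the exchange
  of integrals over the group with integrals over path space.\<close>

lemma haar_measure_sigma_finite:
  fixes lam :: "'g::{topological_ab_group_add, t2_space} measure"
  assumes "sigma_compact_space (euclidean :: 'g topology)" and lam: "haar_measure lam"
  shows "sigma_finite_measure lam"
proof
  obtain \<K> :: "'g set set" where \<K>: "countable \<K>" "\<And>K. K \<in> \<K> \<Longrightarrow> compact K" "\<Union>\<K> = UNIV"
    using assms(1) by (auto simp: sigma_compact_space_def)
  have "sets lam = sets borel" "\<And>K. compact K \<Longrightarrow> emeasure lam K < \<infinity>"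
    using lam by (auto simp: haar_measure_def)
  then show "\<exists>A. countable A \<and> A \<subseteq> sets lam \<and> \<Union> A = space lam \<and> (\<forall>a\<in>A. emeasure lam a \<noteq> \<infinity>)"
    using \<K> sets_eq_imp_space_eq[of lam borel]
    by (intro exI[of _ \<K>]) (auto simp: borel_compact less_top[symmetric])
qed

theorem theorem7p3:
  fixes lam :: "'g::{topological_ab_group_add, t2_space} measure"
    and cmul :: "real \<Rightarrow> 'h::polish_space \<Rightarrow> 'h"
    and nrm :: "'h \<Rightarrow> real"
    and F \<nu> :: "('g \<Rightarrow> 'h) measure"
    and \<alpha> :: real
  assumes "locally_compact_space (euclidean :: 'g topology)"
    and "sigma_compact_space (euclidean :: 'g topology)"
    and "haar_measure lam"
    and "function_space cmul nrm F"
    and "\<alpha> > 0"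
    and "stationary_tail_measure lam cmul nrm F \<alpha> \<nu>"
  shows "\<exists>Q. spectral_representation cmul F \<alpha> \<nu> Q \<and>
    (\<forall>g \<in> borel_measurable (F \<Otimes>\<^sub>M borel).
       (\<forall>\<omega>\<in>space F. \<forall>s. \<forall>u>0. g (dilate cmul u \<omega>, s) = (g (\<omega>, s) :: ennreal)) \<longrightarrow>
       (\<integral>\<^sup>+ \<omega>. (\<integral>\<^sup>+ s. g (\<omega>, s) * ennreal (nrm (\<omega> s) powr \<alpha>) \<partial>lam) \<partial>Q) =
       (\<integral>\<^sup>+ \<omega>. (\<integral>\<^sup>+ s. g (shift_by (- s) \<omega>, s) * ennreal (nrm (\<omega> 0) powr \<alpha>) \<partial>lam) \<partial>Q)) \<and>
    (AE s in lam. (\<integral>\<^sup>+ \<omega>. ennreal (nrm (\<omega> s) powr \<alpha>) \<partial>Q) = 1)"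
proof -
  interpret function_space cmul nrm F by fact
  have sets_lam [measurable_cong]: "sets lam = sets borel"
    and lam_compact: "\<And>K. compact K \<Longrightarrow> emeasure lam K < \<infinity>"
    using \<open>haar_measure lam\<close> by (auto simp: haar_measure_def)
  interpret lam: sigma_finite_measure lam
    using assms(2,3) by (rule haar_measure_sigma_finite)
  have tail: "tail_measure lam cmul nrm F \<alpha> \<nu>" and stat: "stationary \<nu>"
    and norm: "emeasure \<nu> {\<omega> \<in> space \<nu>. nrm (\<omega> 0) > 1} = 1"
    using assms(6) by (auto simp: stationary_tail_measure_def)
  have sets_\<nu> [measurable_cong]: "sets \<nu> = sets F"
    using tail by (simp add: tail_measure_def)
  have sp: "space \<nu> = space F"
    using sets_\<nu> by (rule sets_eq_imp_space_eq)
  \<comment> \<open>The normalization excludes the zero measure, for which the mass \<open>c\<close>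
    of \<open>f\<close> would vanish.\<close>
  have "emeasure \<nu> {\<omega> \<in> space \<nu>. nrm (\<omega> 0) > 1} \<le> emeasure \<nu> (space \<nu>)"
    by (rule emeasure_space)
  then have "emeasure \<nu> (space \<nu>) \<noteq> 0"
    using norm by auto
  then obtain Q where Q: "spectral_representation cmul F \<alpha> \<nu> Q"
    using spectral_representation_exists[OF assms(2) lam.sigma_finite_measure_axioms sets_lam lam_compact tail]
    by blast
  then have sQ [measurable_cong]: "sets Q = sets F" and "prob_space Q"
    by (auto simp: spectral_representation_def)
  interpret Q: prob_space Q by fact
  interpret Ql: pair_sigma_finite Q lam ..
  note shift = nn_integral_spectral_shift[OF \<open>\<alpha> > 0\<close> Q sets_\<nu> stat]
  show ?thesis
  proof (intro exI[of _ Q] conjI ballI impI)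
    show "spectral_representation cmul F \<alpha> \<nu> Q" by (rule Q)
  next
    fix g :: "('g \<Rightarrow> 'h) \<times> 'g \<Rightarrow> ennreal"
    assume [measurable]: "g \<in> borel_measurable (F \<Otimes>\<^sub>M borel)"
      and hom: "\<forall>\<omega>\<in>space F. \<forall>s. \<forall>u>0. g (dilate cmul u \<omega>, s) = g (\<omega>, s)"
    have uminus [measurable]: "(\<lambda>s::'g. - s) \<in> borel_measurable borel"
      by (intro borel_measurable_continuous_onI continuous_intros)
    \<comment> \<open>After exchanging the integrals the identity holds already for each fixed
      \<open>s\<close>, with \<open>g\<close> at that \<open>s\<close> as the 0-homogeneous function
      of the path.\<close>
    have "(\<integral>\<^sup>+ \<omega>. (\<integral>\<^sup>+ s. g (\<omega>, s) * ennreal (nrm (\<omega> s) powr \<alpha>) \<partial>lam) \<partial>Q) =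
      (\<integral>\<^sup>+ s. (\<integral>\<^sup>+ \<omega>. g (\<omega>, s) * ennreal (nrm (\<omega> s) powr \<alpha>) \<partial>Q) \<partial>lam)"
      by (rule Ql.Fubini'[symmetric]) measurable
    also have "\<dots> = (\<integral>\<^sup>+ s. (\<integral>\<^sup>+ \<omega>. g (shift_by (- s) \<omega>, s) * ennreal (nrm (\<omega> 0) powr \<alpha>) \<partial>Q) \<partial>lam)"
      using hom by (intro nn_integral_cong shift) auto
    also have "\<dots> = (\<integral>\<^sup>+ \<omega>. (\<integral>\<^sup>+ s. g (shift_by (- s) \<omega>, s) * ennreal (nrm (\<omega> 0) powr \<alpha>) \<partial>lam) \<partial>Q)"
      by (rule Ql.Fubini') measurable
    finally show "(\<integral>\<^sup>+ \<omega>. (\<integral>\<^sup>+ s. g (\<omega>, s) * ennreal (nrm (\<omega> s) powr \<alpha>) \<partial>lam) \<partial>Q) =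
       (\<integral>\<^sup>+ \<omega>. (\<integral>\<^sup>+ s. g (shift_by (- s) \<omega>, s) * ennreal (nrm (\<omega> 0) powr \<alpha>) \<partial>lam) \<partial>Q)" .
  next
    \<comment> \<open>With the constant function 1, the shift identity reduces the moment at every
      \<open>s\<close> to the one at 0, which is the mass under \<open>\<nu>\<close> of an
      exceedance at 0, normalized to 1.\<close>
    have "(\<integral>\<^sup>+ \<omega>. ennreal (nrm (\<omega> s) powr \<alpha>) \<partial>Q) = 1" for s
    proof -
      have "(\<integral>\<^sup>+ \<omega>. ennreal (nrm (\<omega> s) powr \<alpha>) \<partial>Q) = (\<integral>\<^sup>+ \<omega>. ennreal (nrm (\<omega> 0) powr \<alpha>) \<partial>Q)"
        using shift[of "\<lambda>_. 1" s] by simp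
      also have "\<dots> = (\<integral>\<^sup>+ \<omega>. indicator {\<omega>. nrm (\<omega> 0) > 1} \<omega> \<partial>\<nu>)"
        using nn_integral_spectral_homogeneous[OF \<open>\<alpha> > 0\<close> Q sets_\<nu>, of "\<lambda>_. 1" 0] by simp
      also have "\<dots> = (\<integral>\<^sup>+ \<omega>. indicator {\<omega> \<in> space \<nu>. nrm (\<omega> 0) > 1} \<omega> \<partial>\<nu>)"
        by (intro nn_integral_cong) (simp add: indicator_def)
      also have "\<dots> = 1"
      proof -
        have "{\<omega> \<in> space \<nu>. nrm (\<omega> 0) > 1} \<in> sets \<nu>" by measurable
        then show ?thesis using norm by simp
      qed
      finally show ?thesis .
    qed
    then show "AE s in lam. (\<integral>\<^sup>+ \<omega>. ennreal (nrm (\<omega> s) powr \<alpha>) \<partial>Q) = 1"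
      by simp
  qed
qed

end
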